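(* Let $\alpha=\{\alpha_n\}_{n=0}^\infty$ be a weight sequence (bounded, positive) and assume that the unilateral weighted shift $W_\alpha$ is $2$-hyponormal. Then $W_\alpha$ is positively quadratically hyponormal. More precisely, if $W_\alpha$ is $2$-hyponormal then $$c(n,i)\ \ge\ v_0\cdots v_{i-1}\,u_i\cdots u_n\qquad (n\ge 0,\ 0\le i\le n+1).$$ In particular, if $\alpha$ is strictly increasing and $W_\alpha$ is $2$-hyponormal, then $c(n,i)>0$ for all $n\ge 0$ and $0\le i\le n+1$, i.e. the Maclaurin coefficients of $d_n(t)=\sum_{i=0}^{n+1}c(n,i)t^i$ are positive for all $n\ge 0$.
   Context: For a bounded sequence of positive numbers $\alpha=\{\alpha_n\}_{n\ge 0}$, the unilateral weighted shift $W_\alpha$ on $\ell^2(\mathbb{Z}_+)$ is defined by $W_\alpha e_n=\alpha_n e_{n+1}$, with $\{e_n\}$ the canonical orthonormal basis. Write $[A,B]=AB-BA$. An operator $T$ is $k$-hyponormal if the $k\times k$ operator matrix $([T^{*j},T^i])_{i,j=1}^k$ is positive (semidefinite). Put $\alpha_{-2}=\alpha_{-1}=0$ and, for $n\ge 0$, $$u_n=\alpha_n^2-\alpha_{n-1}^2,\qquad v_n=\alpha_n^2\alpha_{n+1}^2-\alpha_{n-1}^2\alpha_{n-2}^2,\qquad w_n=\alpha_n^2(\alpha_{n+1}^2-\alpha_{n-1}^2)^2.$$ For $s\in\mathbb{C}$ let $D_n(s)=P_n[(W_\alpha+sW_\alpha^2)^*,\,W_\alpha+sW_\alpha^2]P_n$,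 regarded as an $(n+1)\times(n+1)$ matrix, where $P_n$ is the orthogonal projection onto the span of $e_0,\dots,e_n$; it is tridiagonal with diagonal entries $q_m=u_m+|s|^2v_m$ ($0\le m\le n$), subdiagonal entries $r_m=s\sqrt{w_m}$ and superdiagonal entries $\bar r_m$ ($0\le m\le n-1$). Then $\det D_n(s)$ is a polynomial of degree at most $n+1$ in $t=|s|^2$; write $d_n(t)=\det D_n(s)=\sum_{i=0}^{n+1}c(n,i)t^i$. The shift $W_\alpha$ is called positively quadratically hyponormal if $c(n,i)\ge 0$ for all $n\ge 0$ and $0\le i\le n+1$. In the product $v_0\cdots v_{i-1}u_i\cdots u_n$ empty products equal $1$ (so it is $u_0\cdots u_n$ for $i=0$ and $v_0\cdots v_n$ for $i=n+1$). *)

theory Defs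
  imports Complex_Main "HOL-Library.Complex_Order" "Jordan_Normal_Form.Determinant"
begin

section \<open>The Hilbert space of square-summable complex sequences\<close>

lemma square_summable_add:
  fixes f g :: "nat \<Rightarrow> complex"
  assumes "summable (\<lambda>n. (cmod (f n))\<^sup>2)" "summable (\<lambda>n. (cmod (g n))\<^sup>2)"
  shows "summable (\<lambda>n. (cmod (f n + g n))\<^sup>2)"
proof (rule summable_comparison_test')
  show "summable (\<lambda>n. 2 * (cmod (f n))\<^sup>2 + 2 * (cmod (g n))\<^sup>2)"
    using assms by (intro summable_add summable_mult)
  fix n
  have "(cmod (f n + g n))\<^sup>2 \<le> (cmod (f n) + cmod (g n))\<^sup>2"
    by (intro power_mono norm_triangle_ineq) auto
  also have "\<dots> \<le> 2 * (cmod (f n))\<^sup>2 + 2 * (cmod (g n))\<^sup>2"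
    using zero_le_power2[of "cmod (f n) - cmod (g n)"]
    by (simp add: power2_eq_square algebra_simps)
  finally show "norm ((cmod (f n + g n))\<^sup>2) \<le> 2 * (cmod (f n))\<^sup>2 + 2 * (cmod (g n))\<^sup>2"
    by simp
qed

typedef ell2 = "{f :: nat \<Rightarrow> complex. summable (\<lambda>n. (cmod (f n))\<^sup>2)}"
  morphisms ell2_nth Abs_ell2
  by (rule exI[of _ "\<lambda>_. 0"]) simp

setup_lifting type_definition_ell2

instantiation ell2 :: ab_group_add
begin

lift_definition zero_ell2 :: ell2 is "\<lambda>_. 0" by simp

lift_definition plus_ell2 :: "ell2 \<Rightarrow> ell2 \<Rightarrow> ell2" is "\<lambda>f g n. f n + g n"
  by (simp add: square_summable_add)

lift_definition uminus_ell2 :: "ell2 \<Rightarrow> ell2" is "\<lambda>f n. - f n" by simp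

lift_definition minus_ell2 :: "ell2 \<Rightarrow> ell2 \<Rightarrow> ell2" is "\<lambda>f g n. f n - g n"
  using square_summable_add[of _ "\<lambda>n. - h n" for h] by force

instance
  by standard (transfer; force)+

end

lift_definition ell2_scale :: "complex \<Rightarrow> ell2 \<Rightarrow> ell2" is "\<lambda>c f n. c * f n"
  by (simp add: norm_mult power_mult_distrib summable_mult)

lift_definition ell2_basis :: "nat \<Rightarrow> ell2" is "\<lambda>m n. if n = m then 1 else 0"
proof -
  fix m :: nat
  show "summable (\<lambda>n. (cmod (if n = m then 1 else 0))\<^sup>2)"
    by (rule summable_finite[of "{m}"]) auto
qed

definition ell2_inner :: "ell2 \<Rightarrow> ell2 \<Rightarrow> complex" where
  "ell2_inner x y = (\<Sum>n. ell2_nth x n * cnj (ell2_nth y n))"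

text \<open>The orthogonal projection onto the span of the basis vectors with index at most \<open>n\<close>.\<close>

lift_definition ell2_proj :: "nat \<Rightarrow> ell2 \<Rightarrow> ell2" is "\<lambda>n f k. if k \<le> n then f k else 0"
proof -
  fix n and f :: "nat \<Rightarrow> complex"
  show "summable (\<lambda>k. (cmod (if k \<le> n then f k else 0))\<^sup>2)"
    by (rule summable_finite[of "{..n}"]) auto
qed


section \<open>Operators, adjoints and k-hyponormality\<close>

text \<open>The adjoint is unspecified for maps that have none; when it exists it is unique even among
  all functions on the space (see \<open>adjoint_eqI\<close> below).\<close>

definition adjoint :: "(ell2 \<Rightarrow> ell2) \<Rightarrow> ell2 \<Rightarrow> ell2" where
  "adjoint T = (THE S. \<forall>x y. ell2_inner (T x) y = ell2_inner x (S y))"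

definition commutator :: "(ell2 \<Rightarrow> ell2) \<Rightarrow> (ell2 \<Rightarrow> ell2) \<Rightarrow> ell2 \<Rightarrow> ell2" where
  "commutator A B = (\<lambda>x. A (B x) - B (A x))"

text \<open>Positivity of an operator matrix, acting on the \<open>k\<close>-fold direct sum of the space with
  itself. The order is the one of \<^theory>\<open>HOL-Library.Complex_Order\<close>: a complex number is
  nonnegative iff it is real and nonnegative.\<close>

definition positive_operator_matrix :: "nat \<Rightarrow> (nat \<Rightarrow> nat \<Rightarrow> ell2 \<Rightarrow> ell2) \<Rightarrow> bool" where
  "positive_operator_matrix k M \<longleftrightarrow>
     (\<forall>x :: nat \<Rightarrow> ell2. 0 \<le> (\<Sum>i = 1..k. \<Sum>j = 1..k. ell2_inner (M i j (x j)) (x i)))"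

definition k_hyponormal :: "nat \<Rightarrow> (ell2 \<Rightarrow> ell2) \<Rightarrow> bool" where
  "k_hyponormal k T \<longleftrightarrow>
     positive_operator_matrix k (\<lambda>i j. commutator (adjoint T ^^ j) (T ^^ i))"


section \<open>Unilateral weighted shifts\<close>

text \<open>The bounded linear operator sending the \<open>n\<close>-th basis vector to \<open>\<alpha> n\<close> times the next one; it
  is meaningful only for bounded \<open>\<alpha>\<close> (see \<open>weighted_shift_nth\<close> and \<open>weighted_shift_basis\<close>).\<close>

definition weighted_shift :: "(nat \<Rightarrow> real) \<Rightarrow> ell2 \<Rightarrow> ell2" where
  "weighted_shift \<alpha> x =
     Abs_ell2 (\<lambda>n. case n of 0 \<Rightarrow> 0 | Suc m \<Rightarrow> of_real (\<alpha> m) * ell2_nth x m)"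

definition ext_weight :: "(nat \<Rightarrow> real) \<Rightarrow> int \<Rightarrow> real" where
  "ext_weight \<alpha> k = (if k < 0 then 0 else \<alpha> (nat k))"

definition shift_u :: "(nat \<Rightarrow> real) \<Rightarrow> nat \<Rightarrow> real" where
  "shift_u \<alpha> n = (\<alpha> n)\<^sup>2 - (ext_weight \<alpha> (int n - 1))\<^sup>2"

definition shift_v :: "(nat \<Rightarrow> real) \<Rightarrow> nat \<Rightarrow> real" where
  "shift_v \<alpha> n = (\<alpha> n)\<^sup>2 * (\<alpha> (n + 1))\<^sup>2
     - (ext_weight \<alpha> (int n - 1))\<^sup>2 * (ext_weight \<alpha> (int n - 2))\<^sup>2"

definition quad_pencil :: "(nat \<Rightarrow> real) \<Rightarrow> complex \<Rightarrow> ell2 \<Rightarrow> ell2" where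
  "quad_pencil \<alpha> s = (\<lambda>x. weighted_shift \<alpha> x + ell2_scale s ((weighted_shift \<alpha> ^^ 2) x))"

definition shift_D :: "(nat \<Rightarrow> real) \<Rightarrow> nat \<Rightarrow> complex \<Rightarrow> complex mat" where
  "shift_D \<alpha> n s = mat (n + 1) (n + 1) (\<lambda>(i, j).
     ell2_inner
       (ell2_proj n (commutator (adjoint (quad_pencil \<alpha> s)) (quad_pencil \<alpha> s)
         (ell2_proj n (ell2_basis j))))
       (ell2_basis i))"

text \<open>For bounded \<open>\<alpha>\<close> the determinant is a real polynomial of degree at most \<open>n + 1\<close> in the squared
  modulus of \<open>s\<close>, because the matrix is tridiagonal and Hermitian with the entries given in
  \<open>shift_D_entry\<close> below. The polynomial is unique since its values on the nonnegative reals are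
  prescribed.\<close>

definition shift_d :: "(nat \<Rightarrow> real) \<Rightarrow> nat \<Rightarrow> real poly" where
  "shift_d \<alpha> n =
     (THE p. \<forall>s. det (shift_D \<alpha> n s) = complex_of_real (poly p ((cmod s)\<^sup>2)))"

definition shift_c :: "(nat \<Rightarrow> real) \<Rightarrow> nat \<Rightarrow> nat \<Rightarrow> real" where
  "shift_c \<alpha> n i = coeff (shift_d \<alpha> n) i"

definition positively_quadratically_hyponormal :: "(nat \<Rightarrow> real) \<Rightarrow> bool" where
  "positively_quadratically_hyponormal \<alpha> \<longleftrightarrow> (\<forall>n. \<forall>i \<le> n + 1. 0 \<le> shift_c \<alpha> n i)"


section \<open>The definitions above are meaningful for bounded weights\<close>

lemma ell2_eqI: "(\<And>n. ell2_nth x n = ell2_nth y n) \<Longrightarrow> x = y"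
  by (simp add: ell2_nth_inject[symmetric] fun_eq_iff)

lemma ell2_inner_basis_right: "ell2_inner x (ell2_basis n) = ell2_nth x n"
proof -
  have "(\<Sum>k. ell2_nth x k * cnj (ell2_nth (ell2_basis n) k))
      = (\<Sum>k\<in>{n}. ell2_nth x k * cnj (ell2_nth (ell2_basis n) k))"
    by (rule suminf_finite) (auto simp: ell2_basis.rep_eq)
  then show ?thesis by (simp add: ell2_inner_def ell2_basis.rep_eq)
qed

lemma ell2_inner_basis_left: "ell2_inner (ell2_basis n) x = cnj (ell2_nth x n)"
proof -
  have "(\<Sum>k. ell2_nth (ell2_basis n) k * cnj (ell2_nth x k))
      = (\<Sum>k\<in>{n}. ell2_nth (ell2_basis n) k * cnj (ell2_nth x k))"
    by (rule suminf_finite) (auto simp: ell2_basis.rep_eq)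
  then show ?thesis by (simp add: ell2_inner_def ell2_basis.rep_eq)
qed

lemma adjoint_eqI:
  assumes "\<And>x y. ell2_inner (T x) y = ell2_inner x (S y)"
  shows "adjoint T = S"
  unfolding adjoint_def
proof (rule the_equality)
  fix S' assume S': "\<forall>x y. ell2_inner (T x) y = ell2_inner x (S' y)"
  show "S' = S"
  proof (rule ext, rule ell2_eqI)
    fix y n
    have "ell2_inner (ell2_basis n) (S' y) = ell2_inner (ell2_basis n) (S y)"
      using S' assms by metis
    then show "ell2_nth (S' y) n = ell2_nth (S y) n"
      by (simp add: ell2_inner_basis_left)
  qed
qed (use assms in blast)

lemma ell2_inner_summable: "summable (\<lambda>n. ell2_nth x n * cnj (ell2_nth y n))"
proof (rule summable_comparison_test')
  show "summable (\<lambda>n. (cmod (ell2_nth x n))\<^sup>2 + (cmod (ell2_nth y n))\<^sup>2)"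
    using ell2_nth[of x] ell2_nth[of y] by (intro summable_add) auto
  fix n
  have "0 \<le> (cmod (ell2_nth x n))\<^sup>2 + (cmod (ell2_nth y n))\<^sup>2
           - cmod (ell2_nth x n) * cmod (ell2_nth y n)"
    using sum_squares_bound[of "cmod (ell2_nth x n)" "cmod (ell2_nth y n)"]
      mult_nonneg_nonneg[OF norm_ge_zero[of "ell2_nth x n"] norm_ge_zero[of "ell2_nth y n"]]
    by linarith
  then show "norm (ell2_nth x n * cnj (ell2_nth y n))
      \<le> (cmod (ell2_nth x n))\<^sup>2 + (cmod (ell2_nth y n))\<^sup>2"
    by (simp add: norm_mult)
qed

lemma ell2_inner_add_left: "ell2_inner (x + y) z = ell2_inner x z + ell2_inner y z"
  unfolding ell2_inner_def plus_ell2.rep_eq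
  by (simp add: distrib_right suminf_add[OF ell2_inner_summable ell2_inner_summable])

lemma ell2_inner_add_right: "ell2_inner x (y + z) = ell2_inner x y + ell2_inner x z"
  unfolding ell2_inner_def plus_ell2.rep_eq
  by (simp add: distrib_left suminf_add[OF ell2_inner_summable ell2_inner_summable])

lemma ell2_inner_scale_left: "ell2_inner (ell2_scale c x) y = c * ell2_inner x y"
  unfolding ell2_inner_def ell2_scale.rep_eq
  by (simp add: mult.assoc suminf_mult[OF ell2_inner_summable])

lemma ell2_inner_scale_right: "ell2_inner x (ell2_scale c y) = cnj c * ell2_inner x y"
  unfolding ell2_inner_def ell2_scale.rep_eq
  by (simp add: mult.left_commute suminf_mult[OF ell2_inner_summable])

context
  fixes \<alpha> :: "nat \<Rightarrow> real"
  assumes bounded_weights: "bdd_above (range (\<lambda>n. \<bar>\<alpha> n\<bar>))"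
begin

lemma weights_times_summable:
  assumes "summable (\<lambda>n. (cmod (f n))\<^sup>2)"
  shows "summable (\<lambda>n. (cmod (of_real (\<alpha> n) * f n))\<^sup>2)"
proof -
  obtain B where B: "\<And>n. \<bar>\<alpha> n\<bar> \<le> B"
    using bounded_weights by (auto simp: bdd_above_def)
  show ?thesis
  proof (rule summable_comparison_test')
    show "summable (\<lambda>n. B\<^sup>2 * (cmod (f n))\<^sup>2)"
      using assms by (rule summable_mult)
    fix n
    have "(\<alpha> n)\<^sup>2 \<le> B\<^sup>2"
      using B[of n] by (simp add: abs_le_square_iff[symmetric])
    then show "norm ((cmod (of_real (\<alpha> n) * f n))\<^sup>2) \<le> B\<^sup>2 * (cmod (f n))\<^sup>2"
      by (simp add: norm_mult power_mult_distrib mult_right_mono)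
  qed
qed

lemma weighted_shift_nth:
  "ell2_nth (weighted_shift \<alpha> x) n = (case n of 0 \<Rightarrow> 0 | Suc m \<Rightarrow> of_real (\<alpha> m) * ell2_nth x m)"
proof -
  have "summable (\<lambda>n. (cmod (case Suc n of 0 \<Rightarrow> 0 | Suc m \<Rightarrow> of_real (\<alpha> m) * ell2_nth x m))\<^sup>2)"
    using weights_times_summable[of "ell2_nth x"] ell2_nth[of x] by simp
  then have "summable (\<lambda>n. (cmod (case n of 0 \<Rightarrow> 0 | Suc m \<Rightarrow> of_real (\<alpha> m) * ell2_nth x m))\<^sup>2)"
    by (simp only: summable_Suc_iff[where f = "\<lambda>n. (cmod (case n of 0 \<Rightarrow> 0 | Suc m \<Rightarrow> of_real (\<alpha> m) * ell2_nth x m))\<^sup>2"])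
  then show ?thesis
    by (simp add: weighted_shift_def Abs_ell2_inverse)
qed

lemma weighted_shift_basis:
  "weighted_shift \<alpha> (ell2_basis n) = ell2_scale (of_real (\<alpha> n)) (ell2_basis (n + 1))"
  by (rule ell2_eqI)
     (auto simp: weighted_shift_nth ell2_scale.rep_eq ell2_basis.rep_eq split: nat.splits)

definition backward_shift :: "ell2 \<Rightarrow> ell2" where
  "backward_shift x = Abs_ell2 (\<lambda>n. of_real (\<alpha> n) * ell2_nth x (Suc n))"

lemma backward_shift_nth: "ell2_nth (backward_shift x) n = of_real (\<alpha> n) * ell2_nth x (Suc n)"
proof -
  have "summable (\<lambda>n. (cmod (ell2_nth x (Suc n)))\<^sup>2)"
    using ell2_nth[of x] summable_Suc_iff[of "\<lambda>n. (cmod (ell2_nth x n))\<^sup>2"] by simp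
  from weights_times_summable[OF this] show ?thesis
    by (simp add: backward_shift_def Abs_ell2_inverse)
qed

lemma weighted_shift_inner: "ell2_inner (weighted_shift \<alpha> x) y = ell2_inner x (backward_shift y)"
proof -
  have "ell2_inner (weighted_shift \<alpha> x) y
      = (\<Sum>n. ell2_nth (weighted_shift \<alpha> x) (Suc n) * cnj (ell2_nth y (Suc n)))"
    unfolding ell2_inner_def
    using suminf_split_initial_segment[OF ell2_inner_summable[of "weighted_shift \<alpha> x" y], of 1]
    by (simp add: weighted_shift_nth)
  then show ?thesis
    by (simp add: ell2_inner_def weighted_shift_nth backward_shift_nth mult_ac)
qed

lemma adjoint_weighted_shift: "adjoint (weighted_shift \<alpha>) = backward_shift"
  by (rule adjoint_eqI) (rule weighted_shift_inner)

lemma adjoint_quad_pencil: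
  "adjoint (quad_pencil \<alpha> s)
     = (\<lambda>y. backward_shift y + ell2_scale (cnj s) ((backward_shift ^^ 2) y))"
  by (rule adjoint_eqI)
     (simp add: quad_pencil_def ell2_inner_add_left ell2_inner_add_right ell2_inner_scale_left
        ell2_inner_scale_right weighted_shift_inner eval_nat_numeral)

lemma shift_D_entry:
  assumes "i \<le> n" "j \<le> n"
  shows "shift_D \<alpha> n s $$ (i, j) =
    (if i = j then of_real (shift_u \<alpha> i + (cmod s)\<^sup>2 * shift_v \<alpha> i)
     else if i = j + 1 then s * of_real (\<alpha> j * ((\<alpha> (j + 1))\<^sup>2 - (ext_weight \<alpha> (int j - 1))\<^sup>2))
     else if j = i + 1 then cnj s * of_real (\<alpha> i * ((\<alpha> (i + 1))\<^sup>2 - (ext_weight \<alpha> (int i - 1))\<^sup>2))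
     else 0)"
proof -
  have proj: "ell2_proj n (ell2_basis j) = ell2_basis j"
    using assms by (intro ell2_eqI) (auto simp: ell2_proj.rep_eq ell2_basis.rep_eq)
  have entry: "shift_D \<alpha> n s $$ (i, j)
      = ell2_nth (commutator (adjoint (quad_pencil \<alpha> s)) (quad_pencil \<alpha> s) (ell2_basis j)) i"
    using assms by (simp add: shift_D_def proj ell2_inner_basis_right ell2_proj.rep_eq)
  have w2: "(weighted_shift \<alpha> ^^ 2) x = weighted_shift \<alpha> (weighted_shift \<alpha> x)"
    and b2: "(backward_shift ^^ 2) x = backward_shift (backward_shift x)" for x
    by (simp_all add: eval_nat_numeral)
  have s2: "complex_of_real (cmod s) * (complex_of_real (cmod s) * z) = s * (cnj s * z)" for z
    using complex_norm_square[of s] by (simp add: power2_eq_square mult.assoc[symmetric])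
  consider "i = 0" | "i = 1" | k where "i = Suc (Suc k)"
    by (metis One_nat_def not0_implies_Suc)
  then show ?thesis
    unfolding entry commutator_def adjoint_quad_pencil unfolding quad_pencil_def w2 b2
    by cases
      (auto simp: minus_ell2.rep_eq plus_ell2.rep_eq ell2_scale.rep_eq weighted_shift_nth
        backward_shift_nth ell2_basis.rep_eq shift_u_def shift_v_def ext_weight_def s2
        power2_eq_square algebra_simps nat_add_distrib split: nat.splits)
qed

end

end

theory Submission
  imports Defs
begin

text \<open>Expanding the tridiagonal determinant along its last row gives
  \<open>d\<^sub>n = (u\<^sub>n + v\<^sub>n t) d\<^sub>n\<^sub>-\<^sub>1 - w\<^sub>n\<^sub>-\<^sub>1 t d\<^sub>n\<^sub>-\<^sub>2\<close>, while testing 2-hyponormality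
  on pairs of multiples of \<open>e\<^sub>n\<close> and \<open>e\<^sub>n\<^sub>+\<^sub>1\<close> gives \<open>w\<^sub>n \<le> u\<^sub>n v\<^sub>n\<^sub>+\<^sub>1\<close>.
  Hence the defect \<open>e(n,i) = c(n,i) - u\<^sub>n c(n-1,i)\<close> satisfies \<open>e(n,0) = 0\<close> and
  \<open>e(n,i) \<ge> v\<^sub>n e(n-1,i-1)\<close>, so it is nonnegative, and the lower bound follows by multiplying
  the inequalities \<open>c(n,i) \<ge> u\<^sub>n c(n-1,i)\<close>.\<close>

section \<open>Determinants of tridiagonal matrices\<close>

lemma det_tridiagonal_mat:
  fixes f :: "nat \<times> nat \<Rightarrow> 'a :: comm_ring_1"
  assumes tri: "\<And>i j. i > Suc j \<or> j > Suc i \<Longrightarrow> f (i, j) = 0"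
  shows "det (mat (Suc (Suc n)) (Suc (Suc n)) f) =
    f (Suc n, Suc n) * det (mat (Suc n) (Suc n) f)
      - f (Suc n, n) * f (n, Suc n) * det (mat n n f)"
proof -
  define A where "A = mat (Suc (Suc n)) (Suc (Suc n)) f"
  \<comment> \<open>\<open>B\<close> omits the last row and column \<open>n\<close>. Its last column
    is column \<open>Suc n\<close> of \<open>A\<close> without the bottom entry, so by
    tridiagonality only \<open>f (n, Suc n)\<close> survives there.\<close>
  define B where "B = mat_delete A (Suc n) n"
  have A: "A \<in> carrier_mat (Suc (Suc n)) (Suc (Suc n))"
    by (simp add: A_def)
  have B: "B \<in> carrier_mat (Suc n) (Suc n)"
    by (simp add: A_def B_def mat_delete_def)
  have AA: "mat_delete A (Suc n) (Suc n) = mat (Suc n) (Suc n) f"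
    by (rule eq_matI) (auto simp: A_def mat_delete_def)
  have BB: "mat_delete B n n = mat n n f"
    by (rule eq_matI) (auto simp: A_def B_def mat_delete_def)
  have "det B = (\<Sum>i<Suc n. B $$ (i, n) * cofactor B i n)"
    by (rule laplace_expansion_column[OF B]) simp
  also have "\<dots> = B $$ (n, n) * cofactor B n n"
    using tri by (simp add: B_def A_def mat_delete_def)
  also have "\<dots> = f (n, Suc n) * det (mat n n f)"
    by (simp add: cofactor_def BB) (simp add: B_def A_def mat_delete_def)
  finally have detB: "det B = f (n, Suc n) * det (mat n n f)" .
  have "det A = (\<Sum>j<Suc (Suc n). A $$ (Suc n, j) * cofactor A (Suc n) j)"
    by (rule laplace_expansion_row[OF A]) simp
  also have "\<dots> = A $$ (Suc n, n) * cofactor A (Suc n) n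
      + A $$ (Suc n, Suc n) * cofactor A (Suc n) (Suc n)"
    using tri by (simp add: A_def)
  also have "\<dots> = f (Suc n, Suc n) * det (mat (Suc n) (Suc n) f)
      - f (Suc n, n) * f (n, Suc n) * det (mat n n f)"
    by (simp add: cofactor_def AA B_def[symmetric] detB) (simp add: A_def mult.assoc)
  finally show ?thesis
    by (simp add: A_def)
qed

section \<open>The determinant polynomial and its recursion\<close>

text \<open>A signed square root of \<open>w\<^sub>n\<close>: the off-diagonal entry of
  \<open>shift_D\<close> up to the factor \<open>s\<close> or \<open>cnj s\<close>. Its sign is
  harmless, since the recursion contains only its square.\<close>

definition shift_r :: "(nat \<Rightarrow> real) \<Rightarrow> nat \<Rightarrow> real" where
  "shift_r \<alpha> n = \<alpha> n * ((\<alpha> (n + 1))\<^sup>2 - (ext_weight \<alpha> (int n - 1))\<^sup>2)"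

text \<open>The index is shifted: \<open>shift_poly \<alpha> (Suc n)\<close> is the paper's \<open>d\<^sub>n\<close>.\<close>

fun shift_poly :: "(nat \<Rightarrow> real) \<Rightarrow> nat \<Rightarrow> real poly" where
  "shift_poly \<alpha> 0 = 1"
| "shift_poly \<alpha> (Suc 0) = [:shift_u \<alpha> 0, shift_v \<alpha> 0:]"
| "shift_poly \<alpha> (Suc (Suc n)) =
     [:shift_u \<alpha> (Suc n), shift_v \<alpha> (Suc n):] * shift_poly \<alpha> (Suc n)
       - [:0, (shift_r \<alpha> n)\<^sup>2:] * shift_poly \<alpha> n"

text \<open>The determinants prescribe \<open>shift_d\<close> only at squared moduli, that is, on
  the nonnegative half-line. This set is infinite, which gives uniqueness.\<close>

lemma poly_eqI_nonneg:
  fixes p q :: "real poly"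
  assumes "\<And>t. 0 \<le> t \<Longrightarrow> poly p t = poly q t"
  shows "p = q"
proof (rule ccontr)
  assume "p \<noteq> q"
  then have "finite {t. poly (p - q) t = 0}"
    by (intro poly_roots_finite) simp
  moreover have "{0::real..} \<subseteq> {t. poly (p - q) t = 0}"
    using assms by auto
  ultimately show False
    using infinite_Ici[of "0::real"] finite_subset by blast
qed

lemma det_shift_D:
  assumes bdd: "bdd_above (range (\<lambda>n. \<bar>\<alpha> n\<bar>))"
  shows "det (shift_D \<alpha> n s) = complex_of_real (poly (shift_poly \<alpha> (Suc n)) ((cmod s)\<^sup>2))"
proof -
  define f where "f = (\<lambda>(i, j).
    if i = j then complex_of_real (shift_u \<alpha> i + (cmod s)\<^sup>2 * shift_v \<alpha> i)
    else if i = Suc j then s * of_real (shift_r \<alpha> j)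
    else if j = Suc i then cnj s * of_real (shift_r \<alpha> i) else 0)"
  have D: "shift_D \<alpha> n s = mat (Suc n) (Suc n) f"
  proof (rule eq_matI)
    fix i j
    assume "i < dim_row (mat (Suc n) (Suc n) f)" "j < dim_col (mat (Suc n) (Suc n) f)"
    then show "shift_D \<alpha> n s $$ (i, j) = mat (Suc n) (Suc n) f $$ (i, j)"
      using shift_D_entry[OF bdd, of i n j s] by (simp add: f_def shift_r_def)
  qed (simp_all add: shift_D_def)
  \<comment> \<open>One entry function \<open>f\<close> serves all sizes, so the recursion stays
    within this family; \<open>m = 0\<close> is the empty determinant 1.\<close>
  have "det (mat m m f) = complex_of_real (poly (shift_poly \<alpha> m) ((cmod s)\<^sup>2))" for m
  proof (induction m rule: nat_less_induct)
    case (1 m)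
    consider "m = 0" | "m = 1" | k where "m = Suc (Suc k)"
      by (metis One_nat_def not0_implies_Suc)
    then show ?case
    proof cases
      case 1
      then show ?thesis
        by simp
    next
      case 2
      then show ?thesis
        by (simp add: det_single f_def)
    next
      case 3
      have "f (Suc k, k) * f (k, Suc k) = complex_of_real ((cmod s)\<^sup>2 * (shift_r \<alpha> k)\<^sup>2)"
        using complex_norm_square[of s] by (simp add: f_def power2_eq_square mult_ac)
      moreover have "det (mat m m f) = f (Suc k, Suc k) * det (mat (Suc k) (Suc k) f)
          - f (Suc k, k) * f (k, Suc k) * det (mat k k f)"
        unfolding 3 by (rule det_tridiagonal_mat) (auto simp: f_def)
      moreover have "f (Suc k, Suc k) =
          complex_of_real (shift_u \<alpha> (Suc k) + (cmod s)\<^sup>2 * shift_v \<alpha> (Suc k))"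
        by (simp add: f_def)
      ultimately show ?thesis
        using 1 3 by (simp add: algebra_simps)
    qed
  qed
  then show ?thesis
    by (simp only: D)
qed

lemma shift_d_eq:
  assumes "bdd_above (range (\<lambda>n. \<bar>\<alpha> n\<bar>))"
  shows "shift_d \<alpha> n = shift_poly \<alpha> (Suc n)"
  unfolding shift_d_def
proof (rule the_equality)
  show "\<forall>s. det (shift_D \<alpha> n s) = complex_of_real (poly (shift_poly \<alpha> (Suc n)) ((cmod s)\<^sup>2))"
    using det_shift_D[OF assms] by blast
next
  fix p
  assume p: "\<forall>s. det (shift_D \<alpha> n s) = complex_of_real (poly p ((cmod s)\<^sup>2))"
  show "p = shift_poly \<alpha> (Suc n)"
  proof (rule poly_eqI_nonneg)
    fix t :: real
    assume "0 \<le> t"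
    then show "poly p t = poly (shift_poly \<alpha> (Suc n)) t"
      using p[rule_format, of "of_real (sqrt t)"] det_shift_D[OF assms, of n "of_real (sqrt t)"]
      by simp
  qed
qed

section \<open>Consequences of 2-hyponormality for the weights\<close>

lemma two_hyponormal_form_nonneg:
  fixes a b :: real
  assumes bdd: "bdd_above (range (\<lambda>n. \<bar>\<alpha> n\<bar>))"
    and hyp: "k_hyponormal 2 (weighted_shift \<alpha>)"
  shows "0 \<le> shift_u \<alpha> n * a\<^sup>2 + 2 * shift_r \<alpha> n * a * b + shift_v \<alpha> (Suc n) * b\<^sup>2"
proof -
  \<comment> \<open>The mixed commutators move the index by one, so consecutive basis vectors pick
    up the cross term; the diagonal commutators give \<open>shift_u\<close> at \<open>n\<close> and
    \<open>shift_v\<close> at \<open>Suc n\<close>.\<close>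
  define x where "x i = (if i = Suc 0 then ell2_scale (of_real a) (ell2_basis n)
    else ell2_scale (of_real b) (ell2_basis (Suc n)))" for i
  have "0 \<le> (\<Sum>i = 1..2. \<Sum>j = 1..2. ell2_inner
      (commutator (adjoint (weighted_shift \<alpha>) ^^ j) (weighted_shift \<alpha> ^^ i) (x j)) (x i))"
    using hyp unfolding k_hyponormal_def positive_operator_matrix_def by blast
  also have "\<dots> = complex_of_real
      (shift_u \<alpha> n * a\<^sup>2 + 2 * shift_r \<alpha> n * a * b + shift_v \<alpha> (Suc n) * b\<^sup>2)"
    \<comment> \<open>Splitting off the smallest \<open>n\<close> settles which extended weights are
      0.\<close>
    by (cases n; cases "n - 1")
      (auto simp: x_def numeral_2_eq_2 commutator_def adjoint_weighted_shift[OF bdd]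
        ell2_inner_scale_right ell2_inner_basis_right minus_ell2.rep_eq ell2_scale.rep_eq
        weighted_shift_nth[OF bdd] backward_shift_nth[OF bdd] ell2_basis.rep_eq
        shift_u_def shift_v_def shift_r_def ext_weight_def nat_add_distrib
        algebra_simps split: nat.splits)
  finally show ?thesis
    by (simp add: less_eq_complex_def)
qed

lemma binary_form_nonneg_discriminant:
  fixes u r v :: real
  assumes form: "\<And>a b. 0 \<le> u * a\<^sup>2 + 2 * r * a * b + v * b\<^sup>2"
  shows "r\<^sup>2 \<le> u * v"
proof (cases "v = 0")
  case True
  have "0 \<le> - r\<^sup>2"
    \<comment> \<open>The form is now linear in \<open>b\<close>; with \<open>a = r\<close> this
      \<open>b\<close> makes it equal to \<open>- r\<^sup>2\<close>, which forces
      \<open>r = 0\<close>.\<close>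
    using form[of r "- (u + 1) / 2"] True by (simp add: power2_eq_square field_simps)
  then show ?thesis
    using True by simp
next
  case False
  then have "0 < v"
    using form[of 0 1] by simp
  have "0 \<le> v * (u * v - r\<^sup>2)"
    \<comment> \<open>For \<open>a = v\<close> the form is minimal at
      \<open>b = - r\<close>.\<close>
    using form[of v "- r"] by (simp add: power2_eq_square algebra_simps)
  then show ?thesis
    using \<open>0 < v\<close> by (simp add: zero_le_mult_iff)
qed

section \<open>Coefficients of the determinant polynomials\<close>

text \<open>Written so that the \<open>case\<close> term is exactly the defect; the drop from
  \<open>Suc k\<close> to \<open>k\<close> comes from the factor \<open>t\<close>.\<close>

lemma coeff_shift_poly_Suc_Suc:
  "coeff (shift_poly \<alpha> (Suc (Suc n))) i = shift_u \<alpha> (Suc n) * coeff (shift_poly \<alpha> (Suc n)) i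
    + (case i of 0 \<Rightarrow> 0 | Suc k \<Rightarrow> shift_v \<alpha> (Suc n) * coeff (shift_poly \<alpha> (Suc n)) k
        - (shift_r \<alpha> n)\<^sup>2 * coeff (shift_poly \<alpha> n) k)"
  by (cases i) (simp_all add: mult_pCons_left coeff_pCons)

lemma degree_shift_poly: "degree (shift_poly \<alpha> n) \<le> n"
proof (induction \<alpha> n rule: shift_poly.induct)
  case (3 \<alpha> n)
  have "coeff (shift_poly \<alpha> (Suc (Suc n))) i = 0" if "i > Suc (Suc n)" for i
    using that 3 by (cases i) (simp_all only: coeff_shift_poly_Suc_Suc, auto simp: coeff_eq_0)
  then show ?case
    by (intro degree_le) blast
qed auto

text \<open>The \<open>shift_r\<close> term of the recursion has degree at most
  \<open>Suc n\<close>, so the coefficient of degree \<open>Suc (Suc n)\<close> only picks up a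
  factor \<open>shift_v\<close>.\<close>

lemma coeff_shift_poly_top: "coeff (shift_poly \<alpha> n) n = (\<Prod>j<n. shift_v \<alpha> j)"
proof (induction \<alpha> n rule: shift_poly.induct)
  case (3 \<alpha> n)
  have "coeff (shift_poly \<alpha> n) (Suc n) = 0" "coeff (shift_poly \<alpha> (Suc n)) (Suc (Suc n)) = 0"
    using degree_shift_poly[of \<alpha>] by (auto intro!: coeff_eq_0 simp: le_imp_less_Suc)
  then show ?case
    using 3 by (subst coeff_shift_poly_Suc_Suc) (simp add: mult.commute del: shift_poly.simps)
qed auto

text \<open>The two claims are proved together: bounding the \<open>shift_r\<close> term by
  \<open>w\<close> needs nonnegative coefficients, and the defect inequality passes nonnegativity on
  to the next polynomial.\<close>

lemma coeff_shift_poly_step: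
  assumes u: "\<And>n. 0 \<le> shift_u \<alpha> n" and v: "\<And>n. 0 \<le> shift_v \<alpha> n"
    and w: "\<And>n. (shift_r \<alpha> n)\<^sup>2 \<le> shift_u \<alpha> n * shift_v \<alpha> (Suc n)"
  shows "0 \<le> coeff (shift_poly \<alpha> n) i \<and>
    shift_u \<alpha> n * coeff (shift_poly \<alpha> n) i \<le> coeff (shift_poly \<alpha> (Suc n)) i"
proof (induction n arbitrary: i)
  case 0
  show ?case
    using v by (cases i) (auto simp: coeff_pCons split: nat.splits)
next
  case (Suc n)
  have "0 \<le> shift_v \<alpha> (Suc n) * coeff (shift_poly \<alpha> (Suc n)) k
      - (shift_r \<alpha> n)\<^sup>2 * coeff (shift_poly \<alpha> n) k" for k
  proof -
    have "(shift_r \<alpha> n)\<^sup>2 * coeff (shift_poly \<alpha> n) k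
        \<le> shift_u \<alpha> n * shift_v \<alpha> (Suc n) * coeff (shift_poly \<alpha> n) k"
      using w Suc by (intro mult_right_mono) auto
    also have "\<dots> = shift_v \<alpha> (Suc n) * (shift_u \<alpha> n * coeff (shift_poly \<alpha> n) k)"
      by simp
    also have "\<dots> \<le> shift_v \<alpha> (Suc n) * coeff (shift_poly \<alpha> (Suc n)) k"
      using v Suc by (intro mult_left_mono) auto
    finally show ?thesis
      by simp
  qed
  moreover have "0 \<le> coeff (shift_poly \<alpha> (Suc n)) i"
    using Suc[of i] u[of n] by (meson mult_nonneg_nonneg order_trans)
  ultimately show ?case
    by (simp only: coeff_shift_poly_Suc_Suc) (simp split: nat.split)
qed

text \<open>Induction starts at \<open>n = i\<close>, where the coefficient is the top one and
  equality holds; each further step contributes one factor \<open>shift_u\<close>.\<close>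

lemma coeff_shift_poly_lower_bound:
  assumes u: "\<And>n. 0 \<le> shift_u \<alpha> n" and v: "\<And>n. 0 \<le> shift_v \<alpha> n"
    and w: "\<And>n. (shift_r \<alpha> n)\<^sup>2 \<le> shift_u \<alpha> n * shift_v \<alpha> (Suc n)"
    and "i \<le> n"
  shows "(\<Prod>j<i. shift_v \<alpha> j) * (\<Prod>j=i..<n. shift_u \<alpha> j) \<le> coeff (shift_poly \<alpha> n) i"
  using \<open>i \<le> n\<close>
proof (induction n rule: dec_induct)
  case base
  show ?case
    by (simp add: coeff_shift_poly_top)
next
  case (step n)
  have "(\<Prod>j<i. shift_v \<alpha> j) * (\<Prod>j=i..<Suc n. shift_u \<alpha> j)
      = shift_u \<alpha> n * ((\<Prod>j<i. shift_v \<alpha> j) * (\<Prod>j=i..<n. shift_u \<alpha> j))"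
    using step by simp
  also have "\<dots> \<le> shift_u \<alpha> n * coeff (shift_poly \<alpha> n) i"
    using step u by (intro mult_left_mono)
  also have "\<dots> \<le> coeff (shift_poly \<alpha> (Suc n)) i"
    using coeff_shift_poly_step[OF u v w] by blast
  finally show ?case .
qed

section \<open>Strictly increasing weights and the final bounds\<close>

lemma strict_mono_shift_u_pos:
  assumes pos: "\<And>n. 0 < \<alpha> n" and mono: "strict_mono \<alpha>"
  shows "0 < shift_u \<alpha> n"
proof (cases n)
  case 0
  then show ?thesis
    using pos[of 0] by (simp add: shift_u_def ext_weight_def)
next
  case (Suc m)
  have "(\<alpha> m)\<^sup>2 < (\<alpha> (Suc m))\<^sup>2"
    using pos[of m] strict_monoD[OF mono, of m "Suc m"] by (intro power_strict_mono) auto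
  then show ?thesis
    by (simp add: Suc shift_u_def ext_weight_def)
qed

lemma strict_mono_shift_v_pos:
  assumes pos: "\<And>n. 0 < \<alpha> n" and mono: "strict_mono \<alpha>"
  shows "0 < shift_v \<alpha> n"
proof (cases "n < 2")
  case True
  \<comment> \<open>Here the subtracted product contains a weight of negative index and
    vanishes.\<close>
  then show ?thesis
    using pos[of n] pos[of "Suc n"] by (simp add: shift_v_def ext_weight_def)
next
  case False
  then obtain m where n: "n = Suc (Suc m)"
    by (metis One_nat_def Suc_1 less_Suc_eq_0_disj not0_implies_Suc)
  have "\<alpha> m * \<alpha> (Suc m) < \<alpha> (Suc (Suc m)) * \<alpha> (Suc (Suc (Suc m)))"
    using pos[of m] pos[of "Suc m"] pos[of "Suc (Suc m)"]
    by (intro mult_strict_mono strict_monoD[OF mono]) auto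
  then have "(\<alpha> m * \<alpha> (Suc m))\<^sup>2 < (\<alpha> (Suc (Suc m)) * \<alpha> (Suc (Suc (Suc m))))\<^sup>2"
    using pos[of m] pos[of "Suc m"] by (intro power_strict_mono) auto
  then show ?thesis
    by (simp add: n shift_v_def ext_weight_def power_mult_distrib mult.commute nat_add_distrib)
qed

theorem theorem2p2:
  fixes \<alpha> :: "nat \<Rightarrow> real"
  assumes pos: "\<And>n. 0 < \<alpha> n"
    and bdd: "bdd_above (range \<alpha>)"
    and hyp: "k_hyponormal 2 (weighted_shift \<alpha>)"
  shows "positively_quadratically_hyponormal \<alpha> \<and>
    (\<forall>n. \<forall>i \<le> n + 1.
       shift_c \<alpha> n i \<ge> (\<Prod>j<i. shift_v \<alpha> j) * (\<Prod>j=i..n. shift_u \<alpha> j)) \<and>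
    (strict_mono \<alpha> \<longrightarrow> (\<forall>n. \<forall>i \<le> n + 1. shift_c \<alpha> n i > 0))"
proof -
  have abs_bdd: "bdd_above (range (\<lambda>n. \<bar>\<alpha> n\<bar>))"
    using bdd pos by (simp add: less_imp_le)
  note form = two_hyponormal_form_nonneg[OF abs_bdd hyp]
  have u: "0 \<le> shift_u \<alpha> n" for n
    using form[of n 1 0] by simp
  have v: "0 \<le> shift_v \<alpha> n" for n
    \<comment> \<open>The form at \<open>n - 1\<close> yields \<open>shift_v\<close> at
      \<open>n\<close>; for \<open>n = 0\<close> it is a product of squares.\<close>
    using form[of "n - 1" 0 1] by (cases n) (simp_all add: shift_v_def ext_weight_def)
  have w: "(shift_r \<alpha> n)\<^sup>2 \<le> shift_u \<alpha> n * shift_v \<alpha> (Suc n)" for n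
    using form by (rule binary_form_nonneg_discriminant)
  have c: "shift_c \<alpha> n i = coeff (shift_poly \<alpha> (Suc n)) i" for n i
    by (simp only: shift_c_def shift_d_eq[OF abs_bdd])
  \<comment> \<open>Since \<open>shift_c\<close> at \<open>n\<close> belongs to
    \<open>shift_poly\<close> at \<open>Suc n\<close>, the range \<open>{i..<Suc n}\<close> becomes
    \<open>{i..n}\<close>, and it is empty for \<open>i = n + 1\<close>.\<close>
  have bound: "(\<Prod>j<i. shift_v \<alpha> j) * (\<Prod>j=i..n. shift_u \<alpha> j) \<le> shift_c \<alpha> n i"
    if "i \<le> n + 1" for n i
    using coeff_shift_poly_lower_bound[OF u v w, of i "Suc n"] that
    by (simp add: c atLeastLessThanSuc_atLeastAtMost del: shift_poly.simps)
  have "positively_quadratically_hyponormal \<alpha>"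
    using coeff_shift_poly_step[OF u v w]
    by (simp add: positively_quadratically_hyponormal_def c del: shift_poly.simps)
  moreover have "0 < shift_c \<alpha> n i" if "strict_mono \<alpha>" "i \<le> n + 1" for n i
  proof -
    have "0 < (\<Prod>j<i. shift_v \<alpha> j) * (\<Prod>j=i..n. shift_u \<alpha> j)"
      using strict_mono_shift_u_pos[OF pos that(1)] strict_mono_shift_v_pos[OF pos that(1)]
      by (intro mult_pos_pos prod_pos) auto
    also have "\<dots> \<le> shift_c \<alpha> n i"
      using that(2) by (rule bound)
    finally show ?thesis .
  qed
  ultimately show ?thesis
    using bound by blast
qed

end
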